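(* For all integers $0\leq k\leq n$, \[ S_2[n,k] = (-1)^{n-k} \sum_{j=0}^{n-k} (-1)^j \binom{n-1+j}{n-k+j} \binom{2n-k}{n-k-j} S_1[n-k+j,j]. \]
   Context: Let $q$ be an indeterminate. For $n\geq 0$ let $\mathfrak{S}_n$ be the set of permutations of $\{1,\dots,n\}$. For $\sigma\in\mathfrak{S}_n$, a right-to-left maximum is an index $i$ such that $\sigma(i)>\sigma(j)$ for all $j$ with $i<j\leq n$; let $\mathrm{rlm}(\sigma)$ be their number. An inversion of $\sigma$ is a pair $(i,j)$ with $1\leq i<j\leq n$ and $\sigma(i)>\sigma(j)$; it is special if there exists $k'$ with $j<k'\leq n$ and $\sigma(i)<\sigma(k')$. Let $\mathrm{inv}'(\sigma)$ be the number of special inversions. For $0\leq k\leq n$, define $S_1[n,k]=\sum_{\sigma} q^{\mathrm{inv}'(\sigma)}$, summed over $\sigma\in\mathfrak{S}_n$ with $\mathrm{rlm}(\sigma)=k$. For a set partition $\pi$ of $\{1,\dots,n\}$, draw an arc $(b_t,b_{t+1})$ for each pair of consecutive elements $b_t<b_{t+1}$ of each block $\{b_1<\dots<b_m\}$. A crossing is a pair of arcs $(a,c),(b,d)$ with $a<b<c<d$; let $\mathrm{cro}(\pi)$ be the number of crossings. For $0\leq k\leq n$, define $S_2[n,k]=\sum_\pi q^{\mathrm{cro}(\pi)}$, summed over set partitions $\pi$ of $\{1,\dots,n\}$ into exactly $k$ blocks (so $S_2[0,0]=1$). *)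

theory Defs
  imports
    "HOL-Combinatorics.Permutations"
    "HOL-Library.Disjoint_Sets"
    "HOL-Computational_Algebra.Polynomial"
begin

text \<open>
  Elements of the symmetric group on \<open>{1..n}\<close> are the functions \<open>\<sigma>\<close> with
  \<open>\<sigma> permutes {1..n}\<close>; they are the identity outside \<open>{1..n}\<close>, so each permutation is
  represented exactly once. The indeterminate \<open>q\<close> is the variable of \<open>int poly\<close>, and
  \<open>q ^ m\<close> is \<open>monom 1 m\<close>.
\<close>

definition rl_maxima :: "nat \<Rightarrow> (nat \<Rightarrow> nat) \<Rightarrow> nat set" where
  "rl_maxima n \<sigma> = {i \<in> {1..n}. \<forall>j. i < j \<and> j \<le> n \<longrightarrow> \<sigma> i > \<sigma> j}"

definition rlm :: "nat \<Rightarrow> (nat \<Rightarrow> nat) \<Rightarrow> nat" where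
  "rlm n \<sigma> = card (rl_maxima n \<sigma>)"

definition inversions_of :: "nat \<Rightarrow> (nat \<Rightarrow> nat) \<Rightarrow> (nat \<times> nat) set" where
  "inversions_of n \<sigma> = {(i, j). 1 \<le> i \<and> i < j \<and> j \<le> n \<and> \<sigma> i > \<sigma> j}"

definition special_inversions :: "nat \<Rightarrow> (nat \<Rightarrow> nat) \<Rightarrow> (nat \<times> nat) set" where
  "special_inversions n \<sigma> =
     {(i, j) \<in> inversions_of n \<sigma>. \<exists>k'. j < k' \<and> k' \<le> n \<and> \<sigma> i < \<sigma> k'}"

definition inv' :: "nat \<Rightarrow> (nat \<Rightarrow> nat) \<Rightarrow> nat" where
  "inv' n \<sigma> = card (special_inversions n \<sigma>)"

definition S1 :: "nat \<Rightarrow> nat \<Rightarrow> int poly" where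
  "S1 n k = (\<Sum>\<sigma> | \<sigma> permutes {1..n} \<and> rlm n \<sigma> = k. monom 1 (inv' n \<sigma>))"

definition arcs_of :: "nat set set \<Rightarrow> (nat \<times> nat) set" where
  "arcs_of P = {(a, b). \<exists>B\<in>P. a \<in> B \<and> b \<in> B \<and> a < b \<and> \<not> (\<exists>c\<in>B. a < c \<and> c < b)}"

definition crossings :: "nat set set \<Rightarrow> ((nat \<times> nat) \<times> (nat \<times> nat)) set" where
  "crossings P =
     {((a, c), (b, d)). (a, c) \<in> arcs_of P \<and> (b, d) \<in> arcs_of P \<and> a < b \<and> b < c \<and> c < d}"

definition cro :: "nat set set \<Rightarrow> nat" where
  "cro P = card (crossings P)"

definition S2 :: "nat \<Rightarrow> nat \<Rightarrow> int poly" where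
  "S2 n k = (\<Sum>P | partition_on {1..n} P \<and> card P = k. monom 1 (cro P))"

end

theory Submission
  imports Defs
begin

text \<open>
  Put \<open>m = n - k\<close>. The formula is Lagrange interpolation: there is a polynomial \<open>R\<close> of degree at
  most \<open>2 * m\<close> with \<open>R n = S2 n (n - m)\<close> for \<open>n \<ge> 0\<close> (so \<open>R\<close> vanishes at \<open>1, ..., m\<close>) and
  \<open>R (- j) = S1 (m + j) j\<close> for \<open>j \<ge> 0\<close>, and the right-hand side is the interpolation of \<open>R\<close> at the
  nodes \<open>- m, ..., m\<close>, evaluated at \<open>n\<close>.

  The polynomial comes from letters \<open>U\<close>, \<open>D\<close> with \<open>D U - q U D = 1\<close>. Reading a set partition point
  by point, where \<open>D\<close> opens and \<open>U\<close> closes an arc, its generating function by crossings is a matrix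
  entry of \<open>((1 + U)(1 + D))^n\<close>. In a permutation, match each position that is not a right-to-left
  maximum (letter \<open>D\<close>) with its value (letter \<open>U\<close>); the right-to-left maxima cut the resulting word
  into pieces \<open>D^d U^u\<close> and special inversions become crossings, so the generating function is an
  entry of \<open>((1 - D)^(-1) (1 - U)^(-1))^j\<close>. Up to sign changes these are powers of one operator
  with exponents \<open>n\<close> and \<open>- j\<close>, and both satisfy the same first-order recurrence, with extra
  parameters \<open>k\<close> (number of letters \<open>U\<close>) and \<open>h\<close> (number of unmatched ones). The recurrence forces
  polynomiality in the exponent.
\<close>

section \<open>Polynomial functions on the integers\<close>

text \<open>The q-integer \<open>[h]_q\<close>. The indeterminate is specialised to a real number,
  so that interpolation takes place over a field.\<close>

definition qnum :: "real \<Rightarrow> nat \<Rightarrow> real" where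
  "qnum q h = (\<Sum>i<h. q ^ i)"

text \<open>Polynomial functions of degree at most \<open>d\<close> on the integers, in the binomial
  basis, where taking forward differences only shifts the index.\<close>

definition binom_span :: "nat \<Rightarrow> (int \<Rightarrow> real) \<Rightarrow> bool" where
  "binom_span d f \<longleftrightarrow> (\<exists>c. \<forall>x. f x = (\<Sum>i\<le>d. c i * (of_int x gchoose i)))"

lemma binom_span_mono:
  assumes "binom_span d f" "d \<le> e"
  shows "binom_span e f"
proof -
  obtain c where c: "\<And>x. f x = (\<Sum>i\<le>d. c i * (of_int x gchoose i))"
    using assms(1) by (auto simp: binom_span_def)
  have "f x = (\<Sum>i\<le>e. (if i \<le> d then c i else 0) * (of_int x gchoose i))" for x
    unfolding c using assms(2) by (intro sum.mono_neutral_cong_left) auto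
  thus ?thesis unfolding binom_span_def by (intro exI[of _ "\<lambda>i. if i \<le> d then c i else 0"]) blast
qed

lemma binom_span_const: "binom_span d (\<lambda>_. a)"
proof -
  have "binom_span 0 (\<lambda>_. a)"
    unfolding binom_span_def by (intro exI[of _ "\<lambda>_. a"]) simp
  thus ?thesis by (rule binom_span_mono) simp
qed

lemma binom_span_add:
  assumes "binom_span d f" "binom_span d g"
  shows "binom_span d (\<lambda>x. f x + g x)"
proof -
  obtain c c' where "\<And>x. f x = (\<Sum>i\<le>d. c i * (of_int x gchoose i))"
    "\<And>x. g x = (\<Sum>i\<le>d. c' i * (of_int x gchoose i))"
    using assms by (auto simp: binom_span_def)
  hence "f x + g x = (\<Sum>i\<le>d. (c i + c' i) * (of_int x gchoose i))" for x
    by (simp add: sum.distrib algebra_simps)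
  thus ?thesis unfolding binom_span_def by (intro exI[of _ "\<lambda>i. c i + c' i"]) blast
qed

lemma binom_span_cmult:
  assumes "binom_span d f"
  shows "binom_span d (\<lambda>x. a * f x)"
proof -
  obtain c where "\<And>x. f x = (\<Sum>i\<le>d. c i * (of_int x gchoose i))"
    using assms by (auto simp: binom_span_def)
  hence "a * f x = (\<Sum>i\<le>d. (a * c i) * (of_int x gchoose i))" for x
    by (simp add: sum_distrib_left algebra_simps)
  thus ?thesis unfolding binom_span_def by (intro exI[of _ "\<lambda>i. a * c i"]) blast
qed

lemma int_shift_invariant_const:
  fixes f :: "int \<Rightarrow> 'a"
  assumes "\<And>x. f (x + 1) = f x"
  shows "f x = f 0"
proof (induction x rule: int_induct[of _ 0])
  case (step2 i)
  then show ?case using assms[of "i - 1"] by simp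
qed (simp_all add: assms)

text \<open>By Pascal's rule \<open>x gchoose Suc i\<close> has forward difference
  \<open>x gchoose i\<close>, so the difference can be summed termwise, up to a shift-invariant
  function, which is constant.\<close>

lemma binom_span_antidifference:
  assumes "binom_span d (\<lambda>x. f (x + 1) - f x)"
  shows "binom_span (Suc d) f"
proof -
  obtain c where c: "\<And>x. f (x + 1) - f x = (\<Sum>i\<le>d. c i * (of_int x gchoose i))"
    using assms by (auto simp: binom_span_def)
  define g where "g x = f x - (\<Sum>i\<le>d. c i * (of_int x gchoose Suc i))" for x
  have "g (x + 1) = g x" for x
    using c[of x] by (simp add: g_def gbinomial_Suc_Suc sum.distrib distrib_left)
  hence "g x = g 0" for x by (rule int_shift_invariant_const)
  moreover have "g 0 = f 0" by (simp add: g_def gbinomial_0_left)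
  ultimately have "f x = f 0 + (\<Sum>i\<le>d. c i * (of_int x gchoose Suc i))" for x
    by (metis g_def diff_eq_eq)
  also have "f 0 + (\<Sum>i\<le>d. c i * (of_int x gchoose Suc i)) =
      (\<Sum>i\<le>Suc d. case_nat (f 0) c i * (of_int x gchoose i))" for x
    by (simp add: sum.atMost_Suc_shift del: sum.atMost_Suc)
  finally show ?thesis unfolding binom_span_def by blast
qed

text \<open>
  Every summand of the difference \<open>F (x + 1) k h - F x k h\<close> has a smaller value of \<open>2 * k - h\<close>.
\<close>

lemma binom_span_transfer:
  fixes F :: "int \<Rightarrow> nat \<Rightarrow> nat \<Rightarrow> real"
  assumes zero: "\<And>x k h. h > k \<Longrightarrow> F x k h = 0"
    and rec: "\<And>x k h. F (x + 1) k h = F x k h + qnum q (Suc h) * F x k (Suc h) +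
      (if k = 0 then 0 else qnum q h * F x (k - 1) h + (if h = 0 then 0 else F x (k - 1) (h - 1)))"
  shows "binom_span (2 * k - h) (\<lambda>x. F x k h)"
proof (induction "2 * k - h" arbitrary: k h rule: less_induct)
  case less
  have small: "binom_span e (\<lambda>x. F x k' h')"
    if "2 * k' - h' \<le> e" "e < 2 * k - h" for k' h' e
    using less[of k' h'] that by (auto intro: binom_span_mono)
  show ?case
  proof (cases "h > k")
    case True
    thus ?thesis by (simp add: zero binom_span_const)
  next
    case hk: False
    show ?thesis
    proof (cases k)
      \<comment> \<open>The measure cannot decrease further here. The only other term of the
        recurrence is at \<open>Suc h > k\<close> and vanishes, so \<open>F\<close> does not depend
        on \<open>x\<close>.\<close>
      case 0
      hence "F (x + 1) k h = F x k h" for x using hk by (simp add: rec[of x] zero)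
      hence "(\<lambda>x. F x k h) = (\<lambda>_. F 0 k h)"
        using int_shift_invariant_const[of "\<lambda>x. F x k h"] by blast
      thus ?thesis by (rule ssubst) (rule binom_span_const)
    next
      case (Suc k')
      \<comment> \<open>Since \<open>h \<le> k\<close> and \<open>k \<ge> 1\<close>, the number
        \<open>2 * k - h\<close> is positive and the subtraction of 1 is genuine.\<close>
      define d where "d = 2 * k - h - 1"
      have d: "2 * k - h = Suc d" using Suc hk by (simp add: d_def)
      have "binom_span d (\<lambda>x. qnum q (Suc h) * F x k (Suc h))"
        by (rule binom_span_cmult, rule small) (use d in auto)
      moreover have "binom_span d (\<lambda>x. qnum q h * F x k' h)"
        by (rule binom_span_cmult, rule small) (use d Suc in auto)
      moreover have "binom_span d (\<lambda>x. if h = 0 then 0 else F x k' (h - 1))"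
      proof (cases "h = 0")
        case False
        have "binom_span d (\<lambda>x. F x k' (h - 1))" by (rule small) (use d Suc False in auto)
        thus ?thesis using False by simp
      qed (simp add: binom_span_const)
      ultimately have "binom_span d (\<lambda>x. qnum q (Suc h) * F x k (Suc h) +
          (qnum q h * F x k' h + (if h = 0 then 0 else F x k' (h - 1))))"
        by (intro binom_span_add)
      also have "(\<lambda>x. qnum q (Suc h) * F x k (Suc h) +
          (qnum q h * F x k' h + (if h = 0 then 0 else F x k' (h - 1)))) =
          (\<lambda>x. F (x + 1) k h - F x k h)"
        by (rule ext) (simp add: rec Suc)
      finally show ?thesis unfolding d by (rule binom_span_antidifference)
    qed
  qed
qed

section \<open>Lagrange interpolation at the nodes \<open>- m, ..., m\<close>\<close>

lemma lagrange_interpolation: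
  fixes p :: "'a::field poly"
  assumes "finite X" "degree p < card X"
  shows "poly p x = (\<Sum>a\<in>X. poly p a * (\<Prod>b\<in>X - {a}. (x - b) / (a - b)))"
proof -
  define L where "L a = (\<Prod>b\<in>X - {a}. smult (inverse (a - b)) [:- b, 1:])" for a
  have degL: "degree (L a) \<le> card X - 1" if "a \<in> X" for a
  proof -
    have "degree (L a) \<le> (\<Sum>b\<in>X - {a}. degree (smult (inverse (a - b)) [:- b, 1:]))"
      unfolding L_def by (rule degree_prod_sum_le[unfolded o_def]) (use assms in auto)
    also have "\<dots> \<le> (\<Sum>b\<in>X - {a}. 1)" by (intro sum_mono) simp
    finally show ?thesis using that assms by simp
  qed
  have polyL: "poly (L a) x = (\<Prod>b\<in>X - {a}. (x - b) / (a - b))" for a x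
    by (simp add: L_def poly_prod divide_inverse algebra_simps)
  \<comment> \<open>Both sides have degree below \<open>card X\<close> and agree at every
    node.\<close>
  have "p = (\<Sum>a\<in>X. smult (poly p a) (L a))"
  proof (rule poly_eqI_degree)
    fix y assume y: "y \<in> X"
    have "poly (\<Sum>a\<in>X. smult (poly p a) (L a)) y = (\<Sum>a\<in>X. poly p a * poly (L a) y)"
      by (simp add: poly_sum)
    also have "\<dots> = (\<Sum>a\<in>X. if a = y then poly p a else 0)"
    proof (rule sum.cong)
      fix a assume a: "a \<in> X"
      show "poly p a * poly (L a) y = (if a = y then poly p a else 0)"
      proof (cases "a = y")
        case True
        have "poly (L y) y = 1" unfolding polyL by (intro prod.neutral) auto
        thus ?thesis using True by simp
      next
        case False
        hence "poly (L a) y = 0" unfolding polyL by (intro prod_zero bexI[of _ y]) (use assms y in auto)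
        thus ?thesis using False by simp
      qed
    qed simp
    also have "\<dots> = poly p y" using assms y by simp
    finally show "poly p y = poly (\<Sum>a\<in>X. smult (poly p a) (L a)) y" ..
  next
    have "degree (\<Sum>a\<in>X. smult (poly p a) (L a)) \<le> card X - 1"
      by (intro degree_sum_le assms) (use degL degree_smult_le order_trans in blast)
    thus "degree (\<Sum>a\<in>X. smult (poly p a) (L a)) < card X" using assms by linarith
  qed (use assms in simp)
  hence "poly p x = poly (\<Sum>a\<in>X. smult (poly p a) (L a)) x" by simp
  thus ?thesis by (simp add: poly_sum polyL)
qed

text \<open>Interpolation asks for an actual polynomial with a degree bound; each binomial is a
  product of \<open>i\<close> linear factors over \<open>fact i\<close>.\<close>

lemma binom_span_poly:
  assumes "binom_span d f"
  obtains p :: "real poly" where "degree p \<le> d" "\<And>x. f x = poly p (of_int x)"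
proof -
  obtain c where c: "\<And>x. f x = (\<Sum>i\<le>d. c i * (of_int x gchoose i))"
    using assms by (auto simp: binom_span_def)
  define B :: "nat \<Rightarrow> real poly" where "B i = smult (inverse (fact i)) (\<Prod>j<i. [:- of_nat j, 1:])" for i
  have B: "poly (B i) y = y gchoose i" for i y
    by (simp add: B_def poly_prod gbinomial_prod_rev divide_inverse lessThan_atLeast0 algebra_simps)
  have degB: "degree (B i) \<le> i" for i
  proof -
    have "degree (\<Prod>j<i. [:- of_nat j, 1:] :: real poly) \<le> (\<Sum>j<i. degree ([:- of_nat j, 1:] :: real poly))"
      by (rule degree_prod_sum_le[unfolded o_def]) simp
    thus ?thesis unfolding B_def by (intro order_trans[OF degree_smult_le]) simp
  qed
  show thesis
  proof
    have "degree (smult (c i) (B i)) \<le> d" if "i \<le> d" for i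
      by (meson degree_smult_le degB order_trans that)
    thus "degree (\<Sum>i\<le>d. smult (c i) (B i)) \<le> d"
      by (intro degree_sum_le) auto
    show "f x = poly (\<Sum>i\<le>d. smult (c i) (B i)) (of_int x)" for x
      by (simp add: c poly_sum B)
  qed
qed

text \<open>The nodes on each side of \<open>- j\<close> contribute one binomial coefficient: the
  \<open>m - j\<close> lower ones have positive denominators, the \<open>m + j\<close> upper ones
  negative denominators, whence the sign.\<close>

lemma lagrange_basis_consecutive:
  fixes m n j :: nat
  assumes "j \<le> m" "m \<le> n"
  shows "(\<Prod>b\<in>{- int m..int m} - {- int j}. (real n - of_int b) / (of_int (- int j) - of_int b)) =
    (-1) ^ (m + j) * real ((n + j - 1) choose (m + j)) * real ((n + m) choose (m - j))"
proof -
  let ?f = "\<lambda>b. (real n - of_int b) / (of_int (- int j) - of_int b)"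
  have split: "{- int m..int m} - {- int j} = {- int m..<- int j} \<union> {- int j<..int m}"
    using assms by auto
  have "(\<Prod>b\<in>{- int m..int m} - {- int j}. ?f b) =
      (\<Prod>b\<in>{- int m..<- int j}. ?f b) * (\<Prod>b\<in>{- int j<..int m}. ?f b)"
    unfolding split by (rule prod.union_disjoint) auto
  also have "(\<Prod>b\<in>{- int m..<- int j}. ?f b) =
      (\<Prod>i = 0..<m - j. (real n + real m - real i) / real (m - j - i))"
    by (rule prod.reindex_bij_witness[of _ "\<lambda>i. int i - int m" "\<lambda>b. nat (b + int m)"])
      (use assms in \<open>auto simp: of_nat_diff\<close>)
  also have "\<dots> = (real n + real m) gchoose (m - j)"
    by (simp add: gbinomial_altdef_of_nat)
  also have "\<dots> = real ((n + m) choose (m - j))"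
    by (simp add: binomial_gbinomial)
  also have "(\<Prod>b\<in>{- int j<..int m}. ?f b) =
      (\<Prod>i = 0..<m + j. - ((real n + real j - 1 - real i) / real (Suc i)))"
    by (rule prod.reindex_bij_witness[of _ "\<lambda>i. int i - int j + 1" "\<lambda>b. nat (b + int j - 1)"])
      (auto simp: minus_divide_right)
  also have "\<dots> = (-1) ^ (m + j) * ((\<Prod>i = 0..<m + j. real n + real j - 1 - real i) / fact (m + j))"
    by (simp only: prod_uminus prod_dividef fact_prod_Suc of_nat_prod) simp
  also have "\<dots> = (-1) ^ (m + j) * ((real n + real j - 1) gchoose (m + j))"
    by (simp add: gbinomial_prod_rev)
  also have "(real n + real j - 1) gchoose (m + j) = real ((n + j - 1) choose (m + j))"
  \<comment> \<open>Truncated subtraction matters only for \<open>n = j = 0\<close>; then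
    \<open>m = 0\<close> and both binomials are 1.\<close>
  proof (cases "n + j")
    case (Suc i)
    hence "real n + real j - 1 = real (n + j - 1)" by simp
    thus ?thesis by (simp only: binomial_gbinomial)
  qed (use assms in auto)
  finally show ?thesis by (simp add: algebra_simps)
qed

text \<open>Degree \<open>2 * m\<close> is settled by the \<open>2 * m + 1\<close> nodes
  \<open>- m, ..., m\<close>. The zeros remove the positive nodes, so the value at \<open>n\<close>
  is expressed by values at non-positive arguments alone.\<close>

lemma binom_span_reflection:
  assumes f: "binom_span (2 * m) f" and zero: "\<And>i. 1 \<le> i \<Longrightarrow> i \<le> m \<Longrightarrow> f (int i) = 0" and "m \<le> n"
  shows "f (int n) = (\<Sum>j = 0..m. (-1) ^ (m + j) * real ((n + j - 1) choose (m + j)) *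
    real ((n + m) choose (m - j)) * f (- int j))"
proof -
  obtain p :: "real poly" where p: "degree p \<le> 2 * m" "\<And>x. f x = poly p (of_int x)"
    using binom_span_poly[OF f] by blast
  define X where "X = {- int m..int m}"
  have inj: "inj_on real_of_int B" for B by (auto simp: inj_on_def)
  have "f (int n) = (\<Sum>a\<in>real_of_int ` X. poly p a *
      (\<Prod>b\<in>real_of_int ` X - {a}. (real n - b) / (a - b)))"
    using lagrange_interpolation[of "real_of_int ` X" p "real n"] p inj[of X]
    by (simp add: X_def card_image)
  also have "\<dots> = (\<Sum>a\<in>X. f a * (\<Prod>b\<in>X - {a}. (real n - of_int b) / (of_int a - of_int b)))"
  proof -
    have "real_of_int ` X - {real_of_int a} = real_of_int ` (X - {a})" for a by auto
    thus ?thesis by (simp add: sum.reindex prod.reindex inj p)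
  qed
  also have "\<dots> = (\<Sum>a\<in>{- int m..0}. f a * (\<Prod>b\<in>X - {a}. (real n - of_int b) / (of_int a - of_int b)))"
  proof (rule sum.mono_neutral_right)
    have "f a = 0" if "a \<in> X" "a > 0" for a
      using zero[of "nat a"] that by (auto simp: X_def)
    thus "\<forall>a\<in>X - {- int m..0}. f a * (\<Prod>b\<in>X - {a}. (real n - of_int b) / (of_int a - of_int b)) = 0"
      by (auto simp: X_def)
  qed (auto simp: X_def)
  also have "\<dots> = (\<Sum>j = 0..m. f (- int j) *
      (\<Prod>b\<in>X - {- int j}. (real n - of_int b) / (of_int (- int j) - of_int b)))"
    by (rule sum.reindex_bij_witness[of _ "\<lambda>j. - int j" "\<lambda>a. nat (- a)"]) auto
  also have "\<dots> = (\<Sum>j = 0..m. (-1) ^ (m + j) * real ((n + j - 1) choose (m + j)) *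
    real ((n + m) choose (m - j)) * f (- int j))"
    unfolding X_def by (intro sum.cong refl) (simp only: lagrange_basis_consecutive[OF _ \<open>m \<le> n\<close>] atLeastAtMost_iff mult_ac)
  finally show ?thesis .
qed

section \<open>Sums over subsets and set partitions\<close>

text \<open>The ranks within \<open>S\<close> are \<open>0, ..., card S - 1\<close>, each taken
  once.\<close>

lemma sum_power_rank_below:
  fixes S :: "'a::linorder set"
  assumes "finite S"
  shows "(\<Sum>x\<in>S. q ^ card {y\<in>S. y < x}) = qnum q (card S)"
  using assms
proof (induction rule: finite_linorder_max_induct)
  case empty
  thus ?case by (simp add: qnum_def)
next
  case (insert b A)
  have "b \<notin> A" using insert by auto
  have "{y \<in> insert b A. y < b} = A" using insert by auto
  moreover have "{y \<in> insert b A. y < x} = {y \<in> A. y < x}" if "x \<in> A" for x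
    using insert that by (auto dest: less_asym)
  ultimately show ?case
    using insert \<open>b \<notin> A\<close> by (simp add: qnum_def)
qed

lemma sum_power_rank_above:
  fixes S :: "'a::linorder set"
  assumes "finite S"
  shows "(\<Sum>x\<in>S. q ^ card {y\<in>S. x < y}) = qnum q (card S)"
  using assms
proof (induction rule: finite_linorder_min_induct)
  case empty
  thus ?case by (simp add: qnum_def)
next
  case (insert b A)
  have "b \<notin> A" using insert by auto
  have "{y \<in> insert b A. b < y} = A" using insert by auto
  moreover have "{y \<in> insert b A. x < y} = {y \<in> A. x < y}" if "x \<in> A" for x
    using insert that by (auto dest: less_asym)
  ultimately show ?case
    using insert \<open>b \<notin> A\<close> by (simp add: qnum_def)
qed

text \<open>Double counting: choosing \<open>c\<close> and then \<open>M\<close> is the same as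
  choosing \<open>insert c M\<close> and then one of its elements, and the rank of that element sums
  to a q-integer. This is the source of the weights of the letter \<open>D\<close>.\<close>

lemma sum_marked_subsets:
  fixes D :: "'a::linorder set" and g :: "'a set \<Rightarrow> real"
  assumes "finite D"
  shows "(\<Sum>c\<in>D. \<Sum>M | M \<subseteq> D - {c} \<and> card M = h. g (insert c M) * q ^ card {y\<in>M. y < c}) =
    qnum q (Suc h) * (\<Sum>M | M \<subseteq> D \<and> card M = Suc h. g M)"
proof -
  have fin: "finite {M. M \<subseteq> E \<and> P M}" if "E \<subseteq> D" for E P
    using assms that finite_subset[of _ "Pow D"] by (auto intro: rev_finite_subset[of "Pow D"])
  have fM: "finite M" if "M \<subseteq> D" for M using assms that by (rule rev_finite_subset)
  have "(\<Sum>c\<in>D. \<Sum>M | M \<subseteq> D - {c} \<and> card M = h. g (insert c M) * q ^ card {y\<in>M. y < c}) =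
      (\<Sum>(c, M)\<in>(SIGMA c:D. {M. M \<subseteq> D - {c} \<and> card M = h}). g (insert c M) * q ^ card {y\<in>M. y < c})"
    using assms by (intro sum.Sigma ballI fin) auto
  also have "\<dots> = (\<Sum>(M, c)\<in>(SIGMA M:{M. M \<subseteq> D \<and> card M = Suc h}. M). g M * q ^ card {y\<in>M. y < c})"
  proof (rule sum.reindex_bij_witness[of _ "\<lambda>(M, c). (c, M - {c})" "\<lambda>(c, M). (insert c M, c)"], goal_cases)
    case (1 a)
    then show ?case by auto
  next
    case (2 a)
    then obtain c M where a: "a = (c, M)" "c \<in> D" "M \<subseteq> D - {c}" "card M = h" by auto
    moreover have "finite M" "c \<notin> M" using a fM[of M] by auto
    ultimately show ?case by auto
  next
    case (3 a)
    then show ?case by auto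
  next
    case (4 a)
    then obtain c M where "a = (M, c)" "c \<in> M" "M \<subseteq> D" "card M = Suc h" by auto
    then show ?case by auto
  next
    case (5 a)
    obtain c M where a: "a = (c, M)" by force
    have "{y \<in> insert c M. y < c} = {y \<in> M. y < c}" by auto
    then show ?case using a by simp
  qed
  also have "\<dots> = (\<Sum>M | M \<subseteq> D \<and> card M = Suc h. \<Sum>c\<in>M. g M * q ^ card {y\<in>M. y < c})"
    by (intro sum.Sigma[symmetric] fin ballI fM) auto
  also have "\<dots> = (\<Sum>M | M \<subseteq> D \<and> card M = Suc h. qnum q (Suc h) * g M)"
  proof (rule sum.cong)
    fix M assume "M \<in> {M. M \<subseteq> D \<and> card M = Suc h}"
    thus "(\<Sum>c\<in>M. g M * q ^ card {y\<in>M. y < c}) = qnum q (Suc h) * g M"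
      using sum_power_rank_below[of M q] fM[of M] by (simp add: sum_distrib_left[symmetric])
  qed simp
  finally show ?thesis by (simp add: sum_distrib_left)
qed

lemma sum_subsets_insert:
  assumes "finite D" "a \<notin> D"
  shows "(\<Sum>M | M \<subseteq> insert a D \<and> card M = h. g M) = (\<Sum>M | M \<subseteq> D \<and> card M = h. g M) +
    (if h = 0 then 0 else \<Sum>M | M \<subseteq> D \<and> card M = h - 1. g (insert a M))"
proof -
  have fin: "finite {M. M \<subseteq> D \<and> P M}" for P
    using assms by (auto intro: rev_finite_subset[of "Pow D"])
  have fM: "finite M" if "M \<subseteq> D" for M using assms(1) that by (rule rev_finite_subset)
  let ?J = "{M. M \<subseteq> D \<and> h \<noteq> 0 \<and> card M = h - 1}"
  have "{M. M \<subseteq> insert a D \<and> card M = h} = {M. M \<subseteq> D \<and> card M = h} \<union> insert a ` ?J" (is "?L = ?R")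
  proof (intro equalityI subsetI)
    fix M assume M: "M \<in> ?L"
    show "M \<in> ?R"
    proof (cases "a \<in> M")
      case True
      have "finite M" using M assms(1) by (auto intro: rev_finite_subset[of "insert a D"])
      hence "M = insert a (M - {a})" "M - {a} \<in> ?J" using M True
        by (auto simp: card_Diff_singleton card_gt_0_iff)
      thus ?thesis by blast
    qed (use M in auto)
  next
    fix M assume "M \<in> ?R"
    thus "M \<in> ?L" using fM assms by (auto simp: card_insert_if)
  qed
  moreover have "inj_on (insert a) ?J"
    using assms by (intro inj_onI) (metis (mono_tags, lifting) insert_ident mem_Collect_eq subset_iff)
  moreover have "{M. M \<subseteq> D \<and> card M = h} \<inter> insert a ` ?J = {}" using assms by auto
  ultimately have "(\<Sum>M | M \<subseteq> insert a D \<and> card M = h. g M) =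
      (\<Sum>M | M \<subseteq> D \<and> card M = h. g M) + (\<Sum>M\<in>?J. g (insert a M))"
    by (simp add: sum.union_disjoint fin sum.reindex)
  thus ?thesis by (cases "h = 0") auto
qed

section \<open>Set partitions under insertion of a point\<close>

lemma partition_on_insert_point:
  assumes "a \<notin> A"
  shows "{P. partition_on (insert a A) P} =
    (\<lambda>P. insert {a} P) ` {P. partition_on A P} \<union>
    (\<lambda>(P, B). insert (insert a B) (P - {B})) ` (SIGMA P:{P. partition_on A P}. P)" (is "?L = ?R1 \<union> ?R2")
proof (intro equalityI subsetI)
  fix Q assume "Q \<in> ?L"
  hence Q: "partition_on (insert a A) Q" by simp
  then obtain C where C: "C \<in> Q" "a \<in> C" by (auto simp: partition_on_def)
  have un: "B = C" if "B \<in> Q" "a \<in> B" for B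
    using Q C that by (auto simp: partition_on_def disjoint_def)
  have QC: "partition_on (insert a A - C) (Q - {C})"
    using Q C partition_on_insert[of C "Q - {C}" "insert a A"]
    by (auto simp: partition_on_def disjoint_def disjnt_def insert_absorb)
  \<comment> \<open>The unique block \<open>C\<close> of \<open>a\<close> decides: it is a
    singleton, or removing \<open>a\<close> from it leaves a block of a partition of
    \<open>A\<close>.\<close>
  show "Q \<in> ?R1 \<union> ?R2"
  proof (cases "C = {a}")
    case True
    hence "partition_on A (Q - {C})" using QC assms by simp
    moreover have "Q = insert {a} (Q - {C})" using True C by auto
    ultimately show ?thesis by blast
  next
    case False
    define B where "B = C - {a}"
    have CB: "C = insert a B" "a \<notin> B" "B \<noteq> {}" using False C by (auto simp: B_def)
    have "B \<subseteq> A" using Q C CB by (auto simp: partition_on_def)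
    \<comment> \<open>Otherwise putting \<open>B\<close> in and taking it out again would lose a
      block.\<close>
    have Bn: "B \<notin> Q - {C}"
    proof
      assume B: "B \<in> Q - {C}"
      hence "B \<inter> C = {}" using Q C by (auto simp: partition_on_def disjoint_def)
      thus False using CB by auto
    qed
    have "insert a A - C = A - B" using CB assms \<open>B \<subseteq> A\<close> by auto
    hence "partition_on A (insert B (Q - {C}))"
      using QC CB \<open>B \<subseteq> A\<close> by (subst partition_on_insert) (auto simp: partition_on_def disjnt_def)
    moreover have "insert B (Q - {C}) - {B} = Q - {C}" using Bn by (rule Diff_insert_absorb)
    moreover have "insert (insert a B) (Q - {C}) = Q" using C(1) unfolding CB(1)[symmetric] by (rule insert_Diff)
    ultimately show ?thesis by (intro UnI2 image_eqI[of _ _ "(insert B (Q - {C}), B)"]) simp_all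
  qed
next
  fix Q assume "Q \<in> ?R1 \<union> ?R2"
  thus "Q \<in> ?L"
  proof
    assume "Q \<in> ?R1"
    then obtain P where P: "partition_on A P" "Q = insert {a} P" by auto
    have "insert a A - {a} = A" using assms by auto
    moreover have "disjnt {a} (\<Union>P)" using P assms by (auto simp: partition_on_def)
    ultimately have "partition_on (insert a A) Q" using P by (simp add: partition_on_insert)
    thus ?thesis by simp
  next
    assume "Q \<in> ?R2"
    then obtain P B where P: "partition_on A P" "B \<in> P" "Q = insert (insert a B) (P - {B})" by auto
    have dB: "disjnt B (\<Union>(P - {B}))"
      using P by (auto simp: partition_on_def disjoint_def disjnt_def)
    have BA: "B \<subseteq> A" "B \<noteq> {}" "\<Union>(P - {B}) \<subseteq> A" using P by (auto simp: partition_on_def)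
    have "partition_on A (insert B (P - {B}))" using P by (simp add: insert_absorb)
    hence "partition_on (A - B) (P - {B})" using partition_on_insert[OF dB] by blast
    moreover have "insert a A - insert a B = A - B" using assms by auto
    moreover have "disjnt (insert a B) (\<Union>(P - {B}))"
      using dB BA assms by (auto simp: disjnt_def)
    ultimately have "partition_on (insert a A) Q"
      using BA unfolding P(3) by (subst partition_on_insert) auto
    thus ?thesis by simp
  qed
qed

text \<open>The block containing \<open>a\<close> shows which case occurred and which block was
  extended, so the two maps of \<open>partition_on_insert_point\<close> are injective with disjoint
  images.\<close>

lemma sum_partitions_insert_point:
  assumes "a \<notin> A" "finite A"
  shows "(\<Sum>P | partition_on (insert a A) P. f P) =
    (\<Sum>P | partition_on A P. f (insert {a} P) + (\<Sum>B\<in>P. f (insert (insert a B) (P - {B}))))"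
proof -
  let ?S = "{P. partition_on A P}" and ?m = "\<lambda>(P, B). insert (insert a B) (P - {B})"
  have fin: "finite ?S" using assms(2) by (rule finitely_many_partition_on)
  have finP: "finite P" if "P \<in> ?S" for P using that assms(2) finite_elements by auto
  have aP: "a \<notin> B" "B \<noteq> {}" if "P \<in> ?S" "B \<in> P" for P B using that assms by (auto simp: partition_on_def)
  have inj1: "inj_on (insert {a}) ?S"
    using aP(1) by (intro inj_onI) (metis insert_ident insertI1)
  have inj2: "inj_on ?m (SIGMA P:?S. P)"
  proof (intro inj_onI, clarify)
    fix P B P' B'
    assume P: "partition_on A P" "B \<in> P" and P': "partition_on A P'" "B' \<in> P'"
      and eq: "insert (insert a B) (P - {B}) = insert (insert a B') (P' - {B'})"
    \<comment> \<open>On either side only the extended block contains \<open>a\<close>.\<close>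
    have "insert a B = insert a B'"
      using eq aP(1)[of P'] P' by (metis (no_types, lifting) DiffD1 insert_iff mem_Collect_eq)
    hence B: "B = B'" using aP(1)[of P B] aP(1)[of P' B'] P P' by (metis insert_ident mem_Collect_eq)
    have "insert a B \<notin> P - {B}" "insert a B \<notin> P' - {B}"
      using aP(1) P P' by (metis DiffD1 insertI1 mem_Collect_eq)+
    hence "P - {B} = P' - {B}" using eq B by (metis insert_ident)
    thus "P = P' \<and> B = B'" using P P' B by blast
  qed
  have disj: "insert {a} ` ?S \<inter> ?m ` (SIGMA P:?S. P) = {}"
  proof (rule ccontr)
    assume "insert {a} ` ?S \<inter> ?m ` (SIGMA P:?S. P) \<noteq> {}"
    then obtain P P' B where P: "P \<in> ?S" "P' \<in> ?S" "B \<in> P'" "insert {a} P = insert (insert a B) (P' - {B})"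
      by auto
    hence "{a} = insert a B" using aP(1)[OF P(2)] by (metis (no_types, lifting) DiffD1 insertI1 insert_iff)
    thus False using aP[OF P(2,3)] by auto
  qed
  have "(\<Sum>P | partition_on (insert a A) P. f P) =
      sum f (insert {a} ` ?S) + sum f (?m ` (SIGMA P:?S. P))"
    unfolding partition_on_insert_point[OF assms(1)]
    using fin finP disj by (intro sum.union_disjoint finite_imageI finite_SigmaI) auto
  also have "sum f (?m ` (SIGMA P:?S. P)) = (\<Sum>P\<in>?S. \<Sum>B\<in>P. f (insert (insert a B) (P - {B})))"
    using fin finP by (subst sum.reindex[OF inj2], subst sum.Sigma) (auto intro!: sum.cong)
  finally show ?thesis by (simp add: sum.reindex[OF inj1] sum.distrib)
qed

section \<open>Crossings of set partitions\<close>

text \<open>Stated for arbitrary arc sets, so that arcs can be added one at a time.\<close>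

definition arc_crossings :: "(nat \<times> nat) set \<Rightarrow> ((nat \<times> nat) \<times> nat \<times> nat) set" where
  "arc_crossings E = {((a, c), (b, d)). (a, c) \<in> E \<and> (b, d) \<in> E \<and> a < b \<and> b < c \<and> c < d}"

text \<open>
  The elements of \<open>M\<close> are the right ends of half-arcs coming from infinitely far to the left,
  mutually non-crossing.
\<close>

definition half_crossings :: "(nat \<times> nat) set \<Rightarrow> nat set \<Rightarrow> (nat \<times> nat \<times> nat) set" where
  "half_crossings E M = {(c, (b, d)). c \<in> M \<and> (b, d) \<in> E \<and> b < c \<and> c < d}"

definition marked_crossings :: "(nat \<times> nat) set \<Rightarrow> nat set \<Rightarrow> nat" where
  "marked_crossings E M = card (arc_crossings E) + card (half_crossings E M)"

lemma finite_arc_crossings: "finite E \<Longrightarrow> finite (arc_crossings E)"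
  by (rule finite_subset[of _ "E \<times> E"]) (auto simp: arc_crossings_def)

lemma finite_half_crossings: "finite E \<Longrightarrow> finite M \<Longrightarrow> finite (half_crossings E M)"
  by (rule finite_subset[of _ "M \<times> E"]) (auto simp: half_crossings_def)

text \<open>A half-arc that ends at or before the left end of every arc crosses none of
  them.\<close>

lemma marked_crossings_insert_below:
  assumes "\<And>b d. (b, d) \<in> E \<Longrightarrow> a \<le> b"
  shows "marked_crossings E (insert a M) = marked_crossings E M"
proof -
  have "half_crossings E (insert a M) = half_crossings E M"
    using assms by (fastforce simp: half_crossings_def)
  thus ?thesis by (simp add: marked_crossings_def)
qed

text \<open>With \<open>a\<close> to the left of everything, the new arc crosses the arcs of
  \<open>E\<close> exactly as a half-arc ending at \<open>c\<close> does. In addition it crosses the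
  half-arcs ending between \<open>a\<close> and \<open>c\<close>, whereas half-arcs do not cross
  each other; this gives the extra cardinality.\<close>

lemma marked_crossings_insert_arc:
  assumes "finite E" "finite M" "\<And>b d. (b, d) \<in> E \<Longrightarrow> a < b" "\<And>y. y \<in> M \<Longrightarrow> a < y" "c \<notin> M"
  shows "marked_crossings (insert (a, c) E) M = marked_crossings E (insert c M) + card {y\<in>M. y < c}"
proof -
  have "arc_crossings (insert (a, c) E) =
      arc_crossings E \<union> (\<lambda>(c, e). ((a, c), e)) ` half_crossings E {c}"
    using assms(3) by (fastforce simp: arc_crossings_def half_crossings_def image_iff)
  moreover have "arc_crossings E \<inter> (\<lambda>(c, e). ((a, c), e)) ` half_crossings E {c} = {}"
    using assms(3) by (fastforce simp: arc_crossings_def)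
  moreover have "inj_on (\<lambda>(c, e). ((a, c), e)) (half_crossings E {c})"
    by (auto simp: inj_on_def)
  ultimately have 1: "card (arc_crossings (insert (a, c) E)) =
      card (arc_crossings E) + card (half_crossings E {c})"
    using assms by (simp add: card_Un_disjoint card_image finite_arc_crossings finite_half_crossings)
  have "half_crossings (insert (a, c) E) M =
      half_crossings E M \<union> (\<lambda>y. (y, (a, c))) ` {y\<in>M. y < c}"
    using assms(4) by (fastforce simp: half_crossings_def image_iff)
  moreover have "half_crossings E M \<inter> (\<lambda>y. (y, (a, c))) ` {y\<in>M. y < c} = {}"
    using assms(3) by (fastforce simp: half_crossings_def)
  moreover have "inj_on (\<lambda>y. (y, (a, c))) {y\<in>M. y < c}"
    by (auto simp: inj_on_def)
  ultimately have 2: "card (half_crossings (insert (a, c) E) M) =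
      card (half_crossings E M) + card {y\<in>M. y < c}"
    using assms by (simp add: card_Un_disjoint card_image finite_half_crossings)
  have "half_crossings E (insert c M) = half_crossings E {c} \<union> half_crossings E M"
    by (auto simp: half_crossings_def)
  moreover have "half_crossings E {c} \<inter> half_crossings E M = {}"
    using assms(5) by (auto simp: half_crossings_def)
  ultimately have "card (half_crossings E (insert c M)) =
      card (half_crossings E {c}) + card (half_crossings E M)"
    using assms by (simp add: card_Un_disjoint finite_half_crossings)
  with 1 2 show ?thesis by (simp add: marked_crossings_def)
qed

lemma card_partition_on_le:
  assumes "finite A" "partition_on A P"
  shows "card P \<le> card A"
proof -
  have B: "finite B" "B \<noteq> {}" if "B \<in> P" for B
    using that assms by (auto simp: partition_on_def intro: finite_subset)
  have "card P = (\<Sum>B\<in>P. 1)" by simp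
  also have "\<dots> \<le> (\<Sum>B\<in>P. card B)"
    by (intro sum_mono) (use B in \<open>simp add: Suc_le_eq card_gt_0_iff\<close>)
  also have "\<dots> = card A" using product_partition[OF assms(2)] B by simp
  finally show ?thesis .
qed

section \<open>Arcs and marks when a new least point is added\<close>

lemma finite_arcs_of:
  assumes "partition_on A P" "finite A"
  shows "finite (arcs_of P)"
  by (rule finite_subset[of _ "A \<times> A"]) (use assms in \<open>auto simp: arcs_of_def partition_on_def\<close>)

lemma arcs_of_insert_singleton: "arcs_of (insert {a} P) = arcs_of P"
  by (auto simp: arcs_of_def)

text \<open>Lying below the whole block, \<open>a\<close> has successor \<open>Min B\<close> there
  and separates no two elements of \<open>B\<close>.\<close>

lemma arcs_of_extend_block:
  assumes "B \<in> P" "finite B" "B \<noteq> {}" "\<And>x. x \<in> B \<Longrightarrow> a < x"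
  shows "arcs_of (insert (insert a B) (P - {B})) = insert (a, Min B) (arcs_of P)"
proof -
  have arcs: "arcs_of Q = (\<Union>C\<in>Q. arcs_of {C})" for Q by (auto simp: arcs_of_def)
  have "arcs_of {insert a B} = insert (a, Min B) (arcs_of {B})"
  proof (intro equalityI subrelI)
    fix x y assume "(x, y) \<in> arcs_of {insert a B}"
    hence xy: "x \<in> insert a B" "y \<in> insert a B" "x < y" "\<And>z. z \<in> insert a B \<Longrightarrow> \<not> (x < z \<and> z < y)"
      by (auto simp: arcs_of_def)
    hence "y \<in> B" using assms(4) by force
    show "(x, y) \<in> insert (a, Min B) (arcs_of {B})"
    proof (cases "x = a")
      case True
      have "\<not> Min B < y" using xy(4)[of "Min B"] assms True by auto
      hence "y = Min B" using \<open>y \<in> B\<close> assms by (simp add: antisym not_less)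
      thus ?thesis using True by simp
    next
      case False
      thus ?thesis using xy \<open>y \<in> B\<close> by (auto simp: arcs_of_def)
    qed
  next
    fix x y assume "(x, y) \<in> insert (a, Min B) (arcs_of {B})"
    thus "(x, y) \<in> arcs_of {insert a B}"
    proof
      assume "(x, y) = (a, Min B)"
      thus ?thesis using assms by (auto simp: arcs_of_def)
    next
      assume "(x, y) \<in> arcs_of {B}"
      thus ?thesis using assms by (auto simp: arcs_of_def dest: less_asym)
    qed
  qed
  hence "arcs_of (insert (insert a B) (P - {B})) =
      insert (a, Min B) (arcs_of {B} \<union> (\<Union>C\<in>P - {B}. arcs_of {C}))"
    by (subst arcs) simp
  also have "arcs_of {B} \<union> (\<Union>C\<in>P - {B}. arcs_of {C}) = arcs_of P"
    using assms(1) by (subst (3) arcs) blast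
  finally show ?thesis .
qed

text \<open>
  A marked block, recorded by its minimum, is one that is to be continued to the left.
\<close>

definition marked_sum :: "real \<Rightarrow> nat set set \<Rightarrow> nat \<Rightarrow> real" where
  "marked_sum q P h =
    (\<Sum>M | M \<subseteq> Min ` P \<and> card M = h. q ^ marked_crossings (arcs_of P) M)"

text \<open>
  The parameter \<open>k\<close> is the number of right ends of arcs and half-arcs.
\<close>

definition partition_weight :: "real \<Rightarrow> nat set \<Rightarrow> nat \<Rightarrow> nat \<Rightarrow> real" where
  "partition_weight q A k h =
    (\<Sum>P | partition_on A P. if card P + k = card A + h then marked_sum q P h else 0)"

text \<open>The new block is left unmarked or is marked; a mark at the leftmost point causes no
  crossing.\<close>

lemma marked_sum_insert_singleton:
  assumes P: "partition_on A P" "finite A" and a: "\<And>x. x \<in> A \<Longrightarrow> a < x"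
  shows "marked_sum q (insert {a} P) h =
    marked_sum q P h + (if h = 0 then 0 else marked_sum q P (h - 1))"
proof -
  have "a \<le> b" if "(b, d) \<in> arcs_of P" for b d
    using that P a by (force simp: arcs_of_def partition_on_def)
  hence st: "marked_crossings (arcs_of P) (insert a M) = marked_crossings (arcs_of P) M" for M
    by (rule marked_crossings_insert_below)
  have fin: "finite P" using P finite_elements by blast
  have "Min B \<in> A" if "B \<in> P" for B
    using that P by (metis Min_in UnionI finite_subset partition_onD1 partition_onD3 Union_upper)
  hence "a \<notin> Min ` P" using a by blast
  thus ?thesis
    unfolding marked_sum_def arcs_of_insert_singleton image_insert Min_singleton
    using fin by (subst sum_subsets_insert) (simp_all add: st)
qed

text \<open>The new arc behaves like a mark at \<open>Min B\<close> and also crosses the marks below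
  it, so summing over the blocks is an instance of \<open>sum_marked_subsets\<close>. The two terms
  belong to \<open>a\<close> unmarked and \<open>a\<close> marked.\<close>

lemma sum_marked_sum_extend_block:
  assumes P: "partition_on A P" "finite A" and a: "\<And>x. x \<in> A \<Longrightarrow> a < x"
  shows "(\<Sum>B\<in>P. marked_sum q (insert (insert a B) (P - {B})) h) =
    qnum q (Suc h) * marked_sum q P (Suc h) + qnum q h * marked_sum q P h"
proof -
  define E where "E = arcs_of P"
  define D where "D = Min ` P"
  have fin: "finite P" using P finite_elements by blast
  have B: "finite B" "B \<noteq> {}" "B \<subseteq> A" if "B \<in> P" for B
    using that P by (auto simp: partition_on_def intro: finite_subset)
  have MinB: "Min B \<in> B" if "B \<in> P" for B using B[OF that] by simp
  have inj: "inj_on Min P"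
  proof (rule inj_onI)
    fix B C assume BC: "B \<in> P" "C \<in> P" "Min B = Min C"
    hence "Min B \<in> B \<inter> C" using MinB by (metis IntI)
    thus "B = C" using P BC by (auto simp: partition_on_def disjoint_def)
  qed
  have DA: "D \<subseteq> A" using MinB B by (force simp: D_def)
  have finD: "finite D" using fin by (simp add: D_def)
  have finE: "finite E" using P by (simp add: E_def finite_arcs_of)
  have aE: "a < b" if "(b, d) \<in> E" for b d
    using that P a by (force simp: E_def arcs_of_def partition_on_def)
  have aD: "a \<notin> D" using DA a by blast
  \<comment> \<open>\<open>T j\<close> picks the minimum \<open>c\<close> that becomes the right end
    of the new arc, then \<open>j\<close> marks among the other minima.\<close>
  define T where "T j = (\<Sum>c\<in>D. \<Sum>M | M \<subseteq> D - {c} \<and> card M = j.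
      q ^ marked_crossings E (insert c M) * q ^ card {y\<in>M. y < c})" for j
  have T: "T j = qnum q (Suc j) * marked_sum q P (Suc j)" for j
    unfolding T_def marked_sum_def E_def[symmetric] D_def[symmetric]
    by (rule sum_marked_subsets[OF finD])
  have ext: "marked_sum q (insert (insert a B) (P - {B})) h =
      (\<Sum>M | M \<subseteq> D - {Min B} \<and> card M = h.
        q ^ marked_crossings E (insert (Min B) M) * q ^ card {y\<in>M. y < Min B}) +
      (if h = 0 then 0 else \<Sum>M | M \<subseteq> D - {Min B} \<and> card M = h - 1.
        q ^ marked_crossings E (insert (Min B) M) * q ^ card {y\<in>M. y < Min B})"
    if "B \<in> P" for B
  proof -
    let ?E = "insert (a, Min B) E"
    have arcs: "arcs_of (insert (insert a B) (P - {B})) = ?E"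
      unfolding E_def using that B[OF that] a by (intro arcs_of_extend_block) auto
    have "Min (insert a B) = a"
      using B[OF that] a by (intro Min_eqI) (auto intro: less_imp_le)
    moreover have "Min ` (P - {B}) = D - {Min B}"
      using inj_on_image_set_diff[OF inj, of P "{B}"] that by (simp add: D_def)
    ultimately have minima: "Min ` insert (insert a B) (P - {B}) = insert a (D - {Min B})" by simp
    have st: "marked_crossings ?E M = marked_crossings E (insert (Min B) M) + card {y\<in>M. y < Min B}"
      if "M \<subseteq> D - {Min B}" for M
    proof (rule marked_crossings_insert_arc[OF finE])
      show "finite M" using that finD finite_subset by blast
      show "a < y" if "y \<in> M" for y using that \<open>M \<subseteq> D - {Min B}\<close> DA a by blast
    qed (use that aE in auto)
    have st': "marked_crossings ?E (insert a M) = marked_crossings ?E M" for M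
      by (rule marked_crossings_insert_below) (use aE in \<open>auto intro: less_imp_le\<close>)
    show ?thesis
      unfolding marked_sum_def arcs minima using finD aD
      by (subst sum_subsets_insert) (auto simp: st st' power_add intro!: sum.cong arg_cong2[of _ _ _ _ "(+)"])
  qed
  have "(\<Sum>B\<in>P. marked_sum q (insert (insert a B) (P - {B})) h) =
      T h + (if h = 0 then 0 else T (h - 1))"
  proof -
    have "(\<Sum>c\<in>D. g c) = (\<Sum>B\<in>P. g (Min B))" for g :: "nat \<Rightarrow> real"
      unfolding D_def using inj by (simp add: sum.reindex)
    thus ?thesis by (simp add: T_def ext sum.distrib)
  qed
  \<comment> \<open>The case distinction disappears because \<open>qnum q 0 = 0\<close>.\<close>
  also have "\<dots> = qnum q (Suc h) * marked_sum q P (Suc h) + qnum q h * marked_sum q P h"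
    by (cases h) (simp_all add: T qnum_def)
  finally show ?thesis .
qed

text \<open>The least point \<open>a\<close> is an unmarked singleton, joined and unmarked, joined
  and marked, or a marked singleton: the terms \<open>1\<close>, \<open>D\<close>,
  \<open>U D\<close> and \<open>U\<close> of \<open>(1 + U)(1 + D)\<close>. A mark on
  \<open>a\<close> raises \<open>k\<close> by one.\<close>

lemma partition_weight_insert:
  assumes "finite A" and a: "\<And>x. x \<in> A \<Longrightarrow> a < x"
  shows "partition_weight q (insert a A) k h = partition_weight q A k h +
    qnum q (Suc h) * partition_weight q A k (Suc h) +
    (if k = 0 then 0 else qnum q h * partition_weight q A (k - 1) h +
      (if h = 0 then 0 else partition_weight q A (k - 1) (h - 1)))"
proof -
  have aA: "a \<notin> A" using a by blast
  let ?w = "\<lambda>P k h. if card P + k = card A + h then marked_sum q P h else 0"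
  let ?f = "\<lambda>P. if card P + k = card (insert a A) + h then marked_sum q P h else 0"
  have "?f (insert {a} P) + (\<Sum>B\<in>P. ?f (insert (insert a B) (P - {B}))) =
      ?w P k h + qnum q (Suc h) * ?w P k (Suc h) +
      (if k = 0 then 0 else qnum q h * ?w P (k - 1) h + (if h = 0 then 0 else ?w P (k - 1) (h - 1)))"
    if P: "partition_on A P" for P
  proof -
    have fin: "finite P" using P assms finite_elements by blast
    \<comment> \<open>For \<open>k = 0\<close> this bound rules out both joining \<open>a\<close> to
      a block and marking it.\<close>
    have le: "card P \<le> card A" using P assms by (simp add: card_partition_on_le)
    have aP: "a \<notin> \<Union>P" using P aA by (simp add: partition_on_def)
    have c1: "card (insert {a} P) = Suc (card P)" using fin aP by (subst card_insert_disjoint) auto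
    have c2: "card (insert (insert a B) (P - {B})) = card P" if "B \<in> P" for B
    proof -
      have "insert a B \<notin> P - {B}" using aP by auto
      thus ?thesis using fin that card_Suc_Diff1[OF fin that] by simp
    qed
    have "(\<Sum>B\<in>P. ?f (insert (insert a B) (P - {B}))) =
        (if card P + k = Suc (card A) + h
         then \<Sum>B\<in>P. marked_sum q (insert (insert a B) (P - {B})) h else 0)"
      using aA assms by (simp add: c2)
    also have "\<dots> = (if card P + k = Suc (card A) + h
         then qnum q (Suc h) * marked_sum q P (Suc h) + qnum q h * marked_sum q P h else 0)"
      using sum_marked_sum_extend_block[OF P assms] by simp
    finally show ?thesis
      using le aA assms marked_sum_insert_singleton[OF P assms, of q h]
      by (cases k; cases h) (auto simp: c1)
  qed
  hence "partition_weight q (insert a A) k h = (\<Sum>P | partition_on A P.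
      ?w P k h + qnum q (Suc h) * ?w P k (Suc h) +
      (if k = 0 then 0 else qnum q h * ?w P (k - 1) h + (if h = 0 then 0 else ?w P (k - 1) (h - 1))))"
    unfolding partition_weight_def sum_partitions_insert_point[OF aA assms(1)]
    by (intro sum.cong) auto
  thus ?thesis
    by (cases k; cases h)
      (simp_all add: partition_weight_def sum.distrib sum_distrib_left cong: if_cong)
qed

text \<open>Weighted Motzkin paths with \<open>n\<close> steps from height 0 to height
  \<open>h\<close>: level steps have weight 1 or \<open>[h]\<close>, up steps weight 1, down steps
  to \<open>h\<close> weight \<open>[h + 1]\<close>. The parameter \<open>k\<close> counts the up
  steps and the level steps of the second kind.\<close>

primrec path_weight :: "real \<Rightarrow> nat \<Rightarrow> nat \<Rightarrow> nat \<Rightarrow> real" where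
  "path_weight q 0 k h = (if k = 0 \<and> h = 0 then 1 else 0)"
| "path_weight q (Suc n) k h = path_weight q n k h + qnum q (Suc h) * path_weight q n k (Suc h) +
    (if k = 0 then 0 else qnum q h * path_weight q n (k - 1) h +
      (if h = 0 then 0 else path_weight q n (k - 1) (h - 1)))"

text \<open>The points are added from right to left, each as a new minimum, so only their number
  matters.\<close>

lemma partition_weight_eq_path_weight:
  assumes "finite A"
  shows "partition_weight q A k h = path_weight q (card A) k h"
  using assms
proof (induction arbitrary: k h rule: finite_linorder_min_induct)
  case empty
  have P: "{P. partition_on {} P} = {{} :: nat set set}" by (auto simp: partition_on_empty)
  have M: "{M. M \<subseteq> Min ` {} \<and> card M = h} = (if h = 0 then {{} :: nat set} else {})" for h by auto
  have "half_crossings {} {} = {}" "arc_crossings {} = {}"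
    by (auto simp: half_crossings_def arc_crossings_def)
  hence "marked_sum q {} h = (if h = 0 then 1 else 0)" for h
    unfolding marked_sum_def M by (simp add: arcs_of_def marked_crossings_def)
  thus ?case unfolding partition_weight_def P by simp
next
  case (insert a A)
  have "a \<notin> A" using insert by auto
  thus ?case using insert by (simp add: partition_weight_insert)
qed

text \<open>For \<open>h = 0\<close> nothing is marked, and \<open>m = n - card P\<close> is the
  number of arcs.\<close>

lemma S2_eq_path_weight:
  assumes "m \<le> n"
  shows "real_of_int (poly (S2 n (n - m)) q) = path_weight (of_int q) n m 0"
proof -
  have "path_weight (of_int q) n m 0 = partition_weight (of_int q) {1..n} m 0"
    by (simp add: partition_weight_eq_path_weight)
  also have "\<dots> = (\<Sum>P | partition_on {1..n} P. if card P = n - m then of_int q ^ cro P else 0)"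
    unfolding partition_weight_def
  proof (rule sum.cong)
    fix P assume "P \<in> {P. partition_on {1..n} P}"
    hence "finite P" using finite_elements[of "{1..n}" P] by simp
    hence "{M. M \<subseteq> Min ` P \<and> card M = 0} = {{}}"
      by (auto dest: finite_subset)
    moreover have "half_crossings (arcs_of P) {} = {}" by (simp add: half_crossings_def)
    ultimately have "marked_sum (of_int q) P 0 = of_int q ^ cro P"
      unfolding marked_sum_def marked_crossings_def arc_crossings_def cro_def crossings_def by simp
    thus "(if card P + m = card {1..n} + 0 then marked_sum (of_int q) P 0 else 0) =
        (if card P = n - m then of_int q ^ cro P else 0)" using assms by auto
  qed simp
  also have "\<dots> = (\<Sum>P | partition_on {1..n} P \<and> card P = n - m. of_int q ^ cro P)"
    by (subst sum.inter_filter[symmetric]) (simp_all add: finitely_many_partition_on)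
  also have "\<dots> = real_of_int (poly (S2 n (n - m)) q)"
    by (simp add: S2_def poly_sum poly_monom)
  finally show ?thesis ..
qed

text \<open>A contributing partition satisfies \<open>k - h = n - card P\<close>, which cannot be
  negative.\<close>

lemma path_weight_eq_0:
  assumes "h > k"
  shows "path_weight q n k h = 0"
proof -
  have "card P \<le> n" if "partition_on {1..n} P" for P
    using card_partition_on_le[of "{1..n}" P] that by simp
  hence "partition_weight q {1..n} k h = 0"
    using assms unfolding partition_weight_def by (intro sum.neutral) fastforce
  thus ?thesis by (simp add: partition_weight_eq_path_weight)
qed

text \<open>A partition of a nonempty set has a block, which leaves fewer than \<open>n\<close>
  arcs. These are the zeros at \<open>1, ..., m\<close> used in the interpolation.\<close>

lemma path_weight_full_eq_0:
  assumes "1 \<le> n" "n \<le> k"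
  shows "path_weight q n k 0 = 0"
proof -
  have "card P \<noteq> 0" if "partition_on {1..n} P" for P
    using that assms finite_elements[of "{1..n}" P] by (auto simp: partition_on_def)
  hence "partition_weight q {1..n} k 0 = 0"
    using assms unfolding partition_weight_def by (intro sum.neutral) fastforce
  thus ?thesis by (simp add: partition_weight_eq_path_weight)
qed

section \<open>Special inversions of permutations\<close>

text \<open>Permutations become words grown by prepending letters: whether a letter is a
  right-to-left maximum depends only on the letters already present.\<close>

primrec rl_max_count :: "nat list \<Rightarrow> nat" where
  "rl_max_count [] = 0"
| "rl_max_count (x # xs) = rl_max_count xs + (if \<forall>y\<in>set xs. y < x then 1 else 0)"

text \<open>
  The list is a suffix of a word in \<open>{1..N}\<close>. The values not in \<open>xs\<close> lie to the left of its entries,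
  possibly outside the list, so the cardinality counts the special inversions ending at \<open>x\<close>.
\<close>

primrec special_count :: "nat \<Rightarrow> nat list \<Rightarrow> nat" where
  "special_count N [] = 0"
| "special_count N (x # xs) = special_count N xs +
    card {y \<in> {1..N} - set xs. x < y \<and> (\<exists>z\<in>set xs. y < z)}"

lemma rl_max_count_le_length: "rl_max_count xs \<le> length xs"
  by (induction xs) auto

lemma rl_max_count_pos: "xs \<noteq> [] \<Longrightarrow> rl_max_count xs > 0"
proof (induction xs)
  case (Cons x xs)
  thus ?case by (cases xs) auto
qed simp

text \<open>The extra value \<open>Suc N\<close> is exceeded by no entry of \<open>xs\<close>, so it
  is never counted.\<close>

lemma special_count_Suc:
  "set xs \<subseteq> {1..N} \<Longrightarrow> special_count (Suc N) xs = special_count N xs"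
proof (induction xs)
  case (Cons x xs)
  have "{y \<in> {1..Suc N} - set xs. x < y \<and> (\<exists>z\<in>set xs. y < z)} =
      {y \<in> {1..N} - set xs. x < y \<and> (\<exists>z\<in>set xs. y < z)}"
    using Cons.prems by fastforce
  thus ?case using Cons by simp
qed simp

text \<open>Suffixes of permutation words with \<open>h\<close> values still missing; the missing
  values are the unmatched letters \<open>U\<close>.\<close>

definition partial_perms :: "nat \<Rightarrow> nat \<Rightarrow> nat \<Rightarrow> nat list set" where
  "partial_perms N h j =
    {xs. distinct xs \<and> set xs \<subseteq> {1..N} \<and> length xs + h = N \<and> rl_max_count xs = j}"

definition perm_sum :: "real \<Rightarrow> nat \<Rightarrow> nat \<Rightarrow> nat \<Rightarrow> real" where
  "perm_sum q N h j = (\<Sum>xs\<in>partial_perms N h j. q ^ special_count N xs)"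

text \<open>Once \<open>N\<close> has been placed, every missing value has a larger entry to its
  right, so no letter prepended later is a right-to-left maximum. The alternative
  \<open>N = 0\<close> admits the empty word.\<close>

definition top_perms :: "nat \<Rightarrow> nat \<Rightarrow> nat \<Rightarrow> nat list set" where
  "top_perms N h j = {xs \<in> partial_perms N h j. N = 0 \<or> N \<in> set xs}"

definition top_perm_sum :: "real \<Rightarrow> nat \<Rightarrow> nat \<Rightarrow> nat \<Rightarrow> real" where
  "top_perm_sum q N h j = (\<Sum>xs\<in>top_perms N h j. q ^ special_count N xs)"

lemma finite_partial_perms: "finite (partial_perms N h j)"
  by (rule finite_subset[OF _ finite_subset_distinct[of "{1..N}"]]) (auto simp: partial_perms_def)

lemma finite_top_perms: "finite (top_perms N h j)"
  by (simp add: top_perms_def finite_partial_perms)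

text \<open>If \<open>N\<close> is missing, the word lives on \<open>{1..N - 1}\<close> with one
  missing value fewer. Iterated, this is the geometric series \<open>(1 - U)^(-1)\<close>.\<close>

lemma perm_sum_split:
  "perm_sum q N h j = top_perm_sum q N h j +
    (if N = 0 \<or> h = 0 then 0 else perm_sum q (N - 1) (h - 1) j)"
proof -
  have split: "partial_perms N h j = top_perms N h j \<union> {xs \<in> partial_perms N h j. \<not> (N = 0 \<or> N \<in> set xs)}"
    by (auto simp: top_perms_def)
  have "perm_sum q N h j = top_perm_sum q N h j +
      (\<Sum>xs | xs \<in> partial_perms N h j \<and> \<not> (N = 0 \<or> N \<in> set xs). q ^ special_count N xs)"
    unfolding perm_sum_def top_perm_sum_def
    by (subst split, subst sum.union_disjoint)
      (auto simp: finite_top_perms finite_partial_perms top_perms_def)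
  also have "(\<Sum>xs | xs \<in> partial_perms N h j \<and> \<not> (N = 0 \<or> N \<in> set xs). q ^ special_count N xs) =
      (if N = 0 \<or> h = 0 then 0 else perm_sum q (N - 1) (h - 1) j)"
  proof (cases "N = 0 \<or> h = 0")
    \<comment> \<open>If nothing is missing, the word contains all values, \<open>N\<close>
      included.\<close>
    case True
    have "N = 0 \<or> N \<in> set xs" if "xs \<in> partial_perms N h j" for xs
    proof (cases "N = 0")
      case False
      hence "length xs = N" using True that by (simp add: partial_perms_def)
      hence "set xs = {1..N}"
        using that by (intro card_subset_eq) (auto simp: partial_perms_def distinct_card)
      thus ?thesis using False by simp
    qed simp
    hence none: "{xs. xs \<in> partial_perms N h j \<and> \<not> (N = 0 \<or> N \<in> set xs)} = {}" by blast
    show ?thesis using True unfolding none by simp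
  next
    case False
    then obtain M g where N: "N = Suc M" "h = Suc g" by (metis not0_implies_Suc)
    have "set xs \<subseteq> {1..Suc M} \<and> Suc M \<notin> set xs \<longleftrightarrow> set xs \<subseteq> {1..M}" for xs
      by (auto simp: atLeastAtMostSuc_conv)
    hence "{xs. xs \<in> partial_perms N h j \<and> \<not> (N = 0 \<or> N \<in> set xs)} = partial_perms M g j"
      unfolding partial_perms_def N by auto
    moreover have "special_count N xs = special_count M xs" if "xs \<in> partial_perms M g j" for xs
      using that special_count_Suc by (simp add: partial_perms_def N)
    ultimately show ?thesis by (simp add: N perm_sum_def)
  qed
  finally show ?thesis .
qed

text \<open>Remove the first letter. If it is \<open>Suc N\<close>, an arbitrary suffix over
  \<open>{1..N}\<close> with one maximum fewer remains; otherwise it is no maximum, and its special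
  inversions count the missing values above it, which sums to a q-integer. Iterated, this is the
  series \<open>(1 - D)^(-1)\<close>.\<close>

lemma top_perm_sum_Suc:
  "top_perm_sum q (Suc N) h (Suc j) =
    perm_sum q N h j + qnum q (Suc h) * top_perm_sum q (Suc N) (Suc h) (Suc j)"
proof -
  let ?T = "top_perms (Suc N) (Suc h) (Suc j)"
  let ?S = "SIGMA ys:?T. {1..Suc N} - set ys"
  let ?c = "\<lambda>(ys, x). x # ys"
  let ?w = "\<lambda>xs. q ^ special_count (Suc N) xs"
  have split: "top_perms (Suc N) h (Suc j) = (#) (Suc N) ` partial_perms N h j \<union> ?c ` ?S"
  proof (intro equalityI subsetI)
    fix xs assume xs: "xs \<in> top_perms (Suc N) h (Suc j)"
    then obtain x ys where x: "xs = x # ys" by (cases xs) (auto simp: top_perms_def)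
    show "xs \<in> (#) (Suc N) ` partial_perms N h j \<union> ?c ` ?S"
    proof (cases "x = Suc N")
      case True
      hence "set ys \<subseteq> {1..N}" using xs x
        by (auto simp: top_perms_def partial_perms_def atLeastAtMostSuc_conv)
      moreover from this have "\<forall>y\<in>set ys. y < Suc N" by auto
      ultimately have "ys \<in> partial_perms N h j"
        using xs x True by (auto simp: top_perms_def partial_perms_def)
      thus ?thesis using x True by blast
    next
      case False
      hence "Suc N \<in> set ys" "x \<le> Suc N" using xs x by (auto simp: top_perms_def partial_perms_def)
      hence "\<not> (\<forall>y\<in>set ys. y < x)" using False by fastforce
      hence "rl_max_count (x # ys) = rl_max_count ys" by simp
      hence "(ys, x) \<in> ?S"
        using xs x False \<open>Suc N \<in> set ys\<close>
        by (auto simp: top_perms_def partial_perms_def simp del: rl_max_count.simps)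
      thus ?thesis using x by (intro UnI2 image_eqI[of _ _ "(ys, x)"]) simp_all
    qed
  next
    fix xs assume "xs \<in> (#) (Suc N) ` partial_perms N h j \<union> ?c ` ?S"
    thus "xs \<in> top_perms (Suc N) h (Suc j)"
    proof
      assume "xs \<in> (#) (Suc N) ` partial_perms N h j"
      then obtain ys where "xs = Suc N # ys" "ys \<in> partial_perms N h j" by auto
      moreover from this have "\<forall>y\<in>set ys. y < Suc N" by (auto simp: partial_perms_def)
      moreover from this have "Suc N \<notin> set ys" by blast
      moreover from calculation have "set ys \<subseteq> {1..Suc N}" by (auto simp: partial_perms_def)
      ultimately show ?thesis by (simp add: top_perms_def partial_perms_def)
    next
      assume "xs \<in> ?c ` ?S"
      then obtain p where p: "p \<in> ?S" "xs = ?c p" by blast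
      obtain ys x where "p = (ys, x)" by force
      hence ys: "xs = x # ys" "ys \<in> ?T" "x \<in> {1..Suc N}" "x \<notin> set ys" using p by simp_all
      hence "Suc N \<in> set ys" by (simp add: top_perms_def)
      moreover from this have "\<not> (\<forall>y\<in>set ys. y < x)" using ys by fastforce
      hence "rl_max_count (x # ys) = rl_max_count ys" by simp
      ultimately show ?thesis using ys
        by (simp add: top_perms_def partial_perms_def del: rl_max_count.simps)
    qed
  qed
  have disj: "(#) (Suc N) ` partial_perms N h j \<inter> ?c ` ?S = {}"
    by (auto simp: top_perms_def)
  have "top_perm_sum q (Suc N) h (Suc j) =
      sum ?w ((#) (Suc N) ` partial_perms N h j) + sum ?w (?c ` ?S)"
    unfolding top_perm_sum_def split
    by (intro sum.union_disjoint disj finite_imageI finite_SigmaI finite_partial_perms finite_top_perms) auto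
  also have "sum ?w ((#) (Suc N) ` partial_perms N h j) =
      (\<Sum>ys\<in>partial_perms N h j. ?w (Suc N # ys))"
    by (subst sum.reindex) auto
  also have "\<dots> = perm_sum q N h j"
    unfolding perm_sum_def
  proof (rule sum.cong)
    fix ys assume "ys \<in> partial_perms N h j"
    hence "special_count (Suc N) ys = special_count N ys"
      by (simp add: partial_perms_def special_count_Suc)
    moreover have none: "{y \<in> {1..Suc N} - set ys. Suc N < y \<and> (\<exists>z\<in>set ys. y < z)} = {}" by auto
    ultimately show "?w (Suc N # ys) = q ^ special_count N ys"
      by (simp only: special_count.simps none card.empty add_0_right)
  qed simp
  also have "sum ?w (?c ` ?S) = (\<Sum>(ys, x)\<in>?S. ?w (x # ys))"
    by (subst sum.reindex) (auto simp: inj_on_def case_prod_unfold)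
  also have "\<dots> = (\<Sum>ys\<in>?T. \<Sum>x\<in>{1..Suc N} - set ys. ?w (x # ys))"
    by (rule sum.Sigma[symmetric]) (auto simp: finite_top_perms)
  also have "\<dots> = (\<Sum>ys\<in>?T. qnum q (Suc h) * ?w ys)"
  proof (rule sum.cong)
    fix ys assume ys: "ys \<in> ?T"
    define S where "S = {1..Suc N} - set ys"
    have "finite S" by (simp add: S_def)
    have "card S = Suc h"
      using ys by (auto simp: S_def top_perms_def partial_perms_def card_Diff_subset distinct_card)
    have top: "Suc N \<in> set ys" using ys by (simp add: top_perms_def)
    \<comment> \<open>The entry \<open>Suc N\<close> of \<open>ys\<close> exceeds every missing
      value, so the last condition holds automatically.\<close>
    have missing: "{y \<in> {1..Suc N} - set ys. x < y \<and> (\<exists>z\<in>set ys. y < z)} = {y\<in>S. x < y}" for x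
    proof -
      have "\<exists>z\<in>set ys. y < z" if "y \<in> S" for y
        using that top by (intro bexI[of _ "Suc N"]) (auto simp: S_def le_less)
      thus ?thesis by (auto simp: S_def)
    qed
    have "(\<Sum>x\<in>{1..Suc N} - set ys. ?w (x # ys)) = (\<Sum>x\<in>S. ?w ys * q ^ card {y\<in>S. x < y})"
      by (simp only: special_count.simps missing power_add S_def)
    also have "\<dots> = ?w ys * qnum q (card S)"
      by (simp only: sum_distrib_left[symmetric] sum_power_rank_above[OF \<open>finite S\<close>])
    finally show "(\<Sum>x\<in>{1..Suc N} - set ys. ?w (x # ys)) = qnum q (Suc h) * ?w ys"
      by (simp add: \<open>card S = Suc h\<close>)
  qed simp
  finally show ?thesis by (simp add: top_perm_sum_def sum_distrib_left)
qed

lemma top_perm_sum_eq_0: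
  assumes "N < j + h"
  shows "top_perm_sum q N h j = 0"
proof -
  have "\<not> length xs + h = N" if "rl_max_count xs = j" for xs
    using rl_max_count_le_length[of xs] that assms by linarith
  hence "partial_perms N h j = {}" by (auto simp: partial_perms_def)
  thus ?thesis by (simp add: top_perm_sum_def top_perms_def)
qed

lemma top_perm_sum_0: "top_perm_sum q N h 0 = (if N = 0 \<and> h = 0 then 1 else 0)"
proof -
  have "xs \<in> top_perms N h 0 \<longleftrightarrow> xs = [] \<and> N = 0 \<and> h = 0" for xs
    using rl_max_count_pos[of xs] by (cases "xs = []") (auto simp: top_perms_def partial_perms_def)
  hence "top_perms N h 0 = (if N = 0 \<and> h = 0 then {[]} else {})" by auto
  thus ?thesis by (simp add: top_perm_sum_def)
qed

text \<open>Obtained by eliminating \<open>perm_sum\<close> between \<open>perm_sum_split\<close>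
  and \<open>top_perm_sum_Suc\<close>. Here \<open>k\<close> is the number of values that are not
  right-to-left maxima.\<close>

lemma top_perm_sum_recurrence:
  "top_perm_sum q (j + k) h j = top_perm_sum q (Suc j + k) h (Suc j)
    - qnum q (Suc h) * top_perm_sum q (Suc j + k) (Suc h) (Suc j)
    + (if k = 0 then 0 else qnum q h * top_perm_sum q (Suc j + (k - 1)) h (Suc j)
      - (if h = 0 then 0 else top_perm_sum q (Suc j + (k - 1)) (h - 1) (Suc j)))"
proof -
  have 1: "perm_sum q (j + k) h j = top_perm_sum q (Suc j + k) h (Suc j)
      - qnum q (Suc h) * top_perm_sum q (Suc j + k) (Suc h) (Suc j)"
    using top_perm_sum_Suc[of q "j + k" h j] by simp
  show ?thesis
  proof (cases "j + k = 0 \<or> h = 0")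
    case True
    thus ?thesis using 1 perm_sum_split[of q "j + k" h j] by (cases k) (auto simp: qnum_def)
  next
    case False
    then obtain M g where M: "j + k = Suc M" "h = Suc g" by (metis not0_implies_Suc)
    have 2: "perm_sum q M g j = top_perm_sum q (j + k) g (Suc j) - qnum q h * top_perm_sum q (j + k) h (Suc j)"
      using top_perm_sum_Suc[of q M g j] M by simp
    \<comment> \<open>For \<open>k = 0\<close> such words would need \<open>j + 1\<close> maxima
      among \<open>j\<close> values.\<close>
    have "top_perm_sum q (j + k) g (Suc j) = 0" "top_perm_sum q (j + k) h (Suc j) = 0" if "k = 0"
      using that by (auto intro!: top_perm_sum_eq_0)
    thus ?thesis using 1 2 perm_sum_split[of q "j + k" h j] M by (cases k) auto
  qed
qed

section \<open>From permutations as functions to words\<close>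

lemma rl_max_count_map_upt:
  assumes "i \<le> Suc n"
  shows "rl_max_count (map \<sigma> [i..<Suc n]) = card {t \<in> {i..n}. \<forall>j. t < j \<and> j \<le> n \<longrightarrow> \<sigma> t > \<sigma> j}"
  using assms
proof (induction rule: inc_induct)
  case (step i)
  let ?A = "\<lambda>i. {t \<in> {i..n}. \<forall>j. t < j \<and> j \<le> n \<longrightarrow> \<sigma> t > \<sigma> j}"
  have "(\<forall>y\<in>set (map \<sigma> [Suc i..<Suc n]). y < \<sigma> i) \<longleftrightarrow> (\<forall>j. i < j \<and> j \<le> n \<longrightarrow> \<sigma> i > \<sigma> j)"
    by (auto simp: Suc_le_eq less_Suc_eq_le simp del: upt_Suc)
  moreover have "t \<in> {i..n} \<longleftrightarrow> t = i \<or> t \<in> {Suc i..n}" for t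
    using step.hyps by auto
  ultimately have "?A i = ?A (Suc i) \<union> (if \<forall>y\<in>set (map \<sigma> [Suc i..<Suc n]). y < \<sigma> i then {i} else {})"
    by (simp only: split: if_split) blast
  moreover have "card (X \<union> (if b then {i} else {})) = card X + (if b then 1 else 0)"
    if "finite X" "i \<notin> X" for X b using that by simp
  ultimately have "card (?A i) =
      card (?A (Suc i)) + (if \<forall>y\<in>set (map \<sigma> [Suc i..<Suc n]). y < \<sigma> i then 1 else 0)"
    by (simp only:) (simp del: upt_Suc set_map)
  moreover have "[i..<Suc n] = i # [Suc i..<Suc n]" using step.hyps by (intro upt_conv_Cons) simp
  ultimately show ?case using step.IH by (simp only: list.map rl_max_count.simps)
qed simp

text \<open>Downward induction on \<open>i\<close>: prepending \<open>\<sigma> i\<close> adds the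
  special inversions ending at position \<open>i\<close>. Their left ends correspond under
  \<open>\<sigma>\<close> to the values counted, since a value above \<open>\<sigma> i\<close> that
  is absent from the later positions must sit to the left of \<open>i\<close>.\<close>

lemma special_count_map_upt:
  assumes "1 \<le> i" "i \<le> Suc n" and \<sigma>: "\<sigma> permutes {1..n}"
  shows "special_count n (map \<sigma> [i..<Suc n]) = card {(a, b) \<in> special_inversions n \<sigma>. i \<le> b}"
  using assms(2,1)
proof (induction rule: inc_induct)
  case base
  have none: "{(a, b) \<in> special_inversions n \<sigma>. Suc n \<le> b} = {}"
    by (auto simp: special_inversions_def inversions_of_def)
  show ?case unfolding none by simp
next
  case (step i)
  let ?A = "\<lambda>i. {(a, b) \<in> special_inversions n \<sigma>. i \<le> b}"
  let ?C = "{a. (a, i) \<in> special_inversions n \<sigma>}"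
  have inj: "inj \<sigma>" using \<sigma> permutes_inj by blast
  have "special_inversions n \<sigma> \<subseteq> {1..n} \<times> {1..n}"
    by (auto simp: special_inversions_def inversions_of_def)
  hence fin: "finite (special_inversions n \<sigma>)" using finite_subset by blast
  have finC: "finite ?C" by (rule finite_subset[of _ "{1..n}"])
    (auto simp: special_inversions_def inversions_of_def)
  have "?A i = ?A (Suc i) \<union> (\<lambda>a. (a, i)) ` ?C" by (auto simp: Suc_le_eq le_less)
  moreover have "finite (?A (Suc i))" using fin by (rule rev_finite_subset) auto
  moreover have "?A (Suc i) \<inter> (\<lambda>a. (a, i)) ` ?C = {}" by auto
  ultimately have "card (?A i) = card (?A (Suc i)) + card ?C"
    using finC by (simp add: card_Un_disjoint card_image inj_on_def)
  moreover have "{y \<in> {1..n} - \<sigma> ` {Suc i..<Suc n}. \<sigma> i < y \<and> (\<exists>z\<in>\<sigma> ` {Suc i..<Suc n}. y < z)} = \<sigma> ` ?C"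
    (is "?Y = _")
  proof (intro equalityI subsetI)
    fix y assume y: "y \<in> ?Y"
    hence "y \<in> \<sigma> ` {1..n}" using permutes_image[OF \<sigma>] by simp
    then obtain a where a: "y = \<sigma> a" "a \<in> {1..n}" by blast
    have "a < i"
    proof (rule ccontr)
      assume "\<not> a < i"
      hence "a = i \<or> a \<in> {Suc i..<Suc n}" using a by auto
      thus False using y a by auto
    qed
    moreover obtain k where "k \<in> {Suc i..<Suc n}" "y < \<sigma> k" using y by blast
    ultimately have "(a, i) \<in> special_inversions n \<sigma>"
      using y a step.hyps by (auto simp: special_inversions_def inversions_of_def)
    thus "y \<in> \<sigma> ` ?C" using a by blast
  next
    fix y assume "y \<in> \<sigma> ` ?C"
    then obtain a where a: "y = \<sigma> a" "(a, i) \<in> special_inversions n \<sigma>" by auto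
    then obtain k where k: "1 \<le> a" "a < i" "\<sigma> i < \<sigma> a" "i < k" "k \<le> n" "\<sigma> a < \<sigma> k"
      by (auto simp: special_inversions_def inversions_of_def)
    hence "k \<in> {Suc i..<Suc n}" by simp
    moreover have "\<sigma> a \<in> {1..n}" using k permutes_in_image[OF \<sigma>, of a] by simp
    moreover have "\<sigma> a \<notin> \<sigma> ` {Suc i..<Suc n}"
    proof
      assume "\<sigma> a \<in> \<sigma> ` {Suc i..<Suc n}"
      hence "a \<in> {Suc i..<Suc n}" using inj by (simp only: inj_image_mem_iff)
      thus False using k by simp
    qed
    ultimately show "y \<in> ?Y" using k unfolding a(1) by blast
  qed
  moreover have "card (\<sigma> ` ?C) = card ?C" by (rule card_image) (rule inj_on_subset[OF inj subset_UNIV])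
  moreover have "[i..<Suc n] = i # [Suc i..<Suc n]" using step.hyps by (intro upt_conv_Cons) simp
  moreover have "special_count n (map \<sigma> [Suc i..<Suc n]) = card (?A (Suc i))" using step by simp
  ultimately show ?case by (simp only: list.map special_count.simps set_map set_upt)
qed

lemma S1_eq_top_perm_sum: "real_of_int (poly (S1 n j) q) = top_perm_sum (of_int q) n 0 j"
proof -
  let ?list = "\<lambda>\<sigma>. map \<sigma> [1..<Suc n]"
  \<comment> \<open>List positions start at 0, and a permutation must be the identity outside
    \<open>{1..n}\<close>.\<close>
  let ?fun = "\<lambda>xs i. if i \<in> {1..n} then xs ! (i - 1) else i"
  have rl: "rl_max_count (?list \<sigma>) = rlm n \<sigma>" for \<sigma>
    using rl_max_count_map_upt[of 1 n \<sigma>] by (simp add: rlm_def rl_maxima_def)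
  have special: "special_count n (?list \<sigma>) = inv' n \<sigma>" if "\<sigma> permutes {1..n}" for \<sigma>
  proof -
    have "{(a, b) \<in> special_inversions n \<sigma>. 1 \<le> b} = special_inversions n \<sigma>"
      by (auto simp: special_inversions_def inversions_of_def)
    thus ?thesis using special_count_map_upt[OF _ _ that, of 1] by (simp add: inv'_def)
  qed
  have perm_list: "?list \<sigma> \<in> top_perms n 0 (rlm n \<sigma>)" if "\<sigma> permutes {1..n}" for \<sigma>
  proof -
    have "set (?list \<sigma>) = \<sigma> ` {1..n}" by auto
    hence "set (?list \<sigma>) = {1..n}" using permutes_image[OF that] by simp
    moreover have "distinct (?list \<sigma>)"
      using permutes_inj[OF that] by (simp add: distinct_map inj_on_subset)
    ultimately show ?thesis using rl[of \<sigma>] by (auto simp: top_perms_def partial_perms_def)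
  qed
  have list_perm: "?fun xs permutes {1..n}" and list_inv: "?list (?fun xs) = xs"
    if "xs \<in> top_perms n 0 j" for xs
  proof -
    have xs: "distinct xs" "length xs = n" "set xs \<subseteq> {1..n}"
      using that by (auto simp: top_perms_def partial_perms_def)
    show "?fun xs permutes {1..n}"
    proof (rule bij_imp_permutes)
      have "inj_on (?fun xs) {1..n}"
        using xs by (intro inj_onI) (auto simp: nth_eq_iff_index_eq)
      moreover have "?fun xs ` {1..n} \<subseteq> {1..n}"
      proof (rule image_subsetI)
        fix i assume "i \<in> {1..n}"
        moreover from this have "xs ! (i - 1) \<in> set xs" using xs by (intro nth_mem) auto
        ultimately show "?fun xs i \<in> {1..n}" using xs by auto
      qed
      ultimately show "bij_betw (?fun xs) {1..n} {1..n}"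
        unfolding bij_betw_def using endo_inj_surj[OF finite_atLeastAtMost] by blast
    qed auto
    show "?list (?fun xs) = xs"
    proof (rule nth_equalityI)
      show "length (?list (?fun xs)) = length xs" using xs by simp
      show "?list (?fun xs) ! i = xs ! i" if "i < length (?list (?fun xs))" for i
        using that by (simp del: upt_Suc)
    qed
  qed
  have "real_of_int (poly (S1 n j) q) =
      (\<Sum>\<sigma> | \<sigma> permutes {1..n} \<and> rlm n \<sigma> = j. of_int q ^ inv' n \<sigma>)"
    by (simp add: S1_def poly_sum poly_monom)
  also have "\<dots> = top_perm_sum (of_int q) n 0 j"
    unfolding top_perm_sum_def
  proof (rule sum.reindex_bij_witness[of _ ?fun ?list], goal_cases)
    case (1 \<sigma>)
    show ?case
    proof
      fix i
      show "?fun (?list \<sigma>) i = \<sigma> i"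
        using 1 by (cases "i \<in> {1..n}") (auto simp: permutes_not_in simp del: upt_Suc)
    qed
  next
    case (2 \<sigma>)
    thus ?case using perm_list by auto
  next
    case (3 xs)
    thus ?case by (rule list_inv)
  next
    case (4 xs)
    moreover have "rlm n (?fun xs) = rl_max_count xs" using rl[of "?fun xs"] list_inv[OF 4] by simp
    ultimately show ?case using list_perm[OF 4] by (simp add: top_perms_def partial_perms_def)
  next
    case (5 \<sigma>)
    thus ?case using special by simp
  qed
  finally show ?thesis .
qed

section \<open>Extrapolation to negative exponents\<close>

text \<open>
  The two halves glue to a single solution of the recurrence on all integers; the sign makes the
  recurrence of \<open>top_perm_sum\<close>, solved for its smaller index, agree with that of \<open>path_weight\<close>.
\<close>

definition transfer :: "real \<Rightarrow> int \<Rightarrow> nat \<Rightarrow> nat \<Rightarrow> real" where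
  "transfer q x k h = (if x \<ge> 0 then path_weight q (nat x) k h
    else (-1) ^ h * top_perm_sum q (nat (- x) + k) h (nat (- x)))"

lemma transfer_of_nat: "transfer q (int n) k h = path_weight q n k h"
  by (simp add: transfer_def)

text \<open>At \<open>j = 0\<close> the other branch of the definition applies; the halves agree
  there, both being 1 exactly for \<open>k = h = 0\<close>.\<close>

lemma transfer_minus_of_nat:
  "transfer q (- int j) k h = (-1) ^ h * top_perm_sum q (j + k) h j"
  by (cases "j = 0") (auto simp: transfer_def top_perm_sum_0)

lemma transfer_recurrence:
  "transfer q (x + 1) k h = transfer q x k h + qnum q (Suc h) * transfer q x k (Suc h) +
    (if k = 0 then 0 else qnum q h * transfer q x (k - 1) h +
      (if h = 0 then 0 else transfer q x (k - 1) (h - 1)))"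
proof (cases "x \<ge> 0")
  case True
  then obtain n where x: "x = int n" using nonneg_int_cases by blast
  hence "x + 1 = int (Suc n)" by simp
  thus ?thesis unfolding x by (simp only: transfer_of_nat path_weight.simps)
next
  case False
  define j where "j = nat (- x - 1)"
  have x: "x = - int (Suc j)" "x + 1 = - int j" using False by (simp_all add: j_def)
  have "transfer q (x + 1) k h = (-1) ^ h * top_perm_sum q (j + k) h j"
    unfolding x(2) by (rule transfer_minus_of_nat)
  \<comment> \<open>The factor \<open>(-1) ^ h\<close> reverses the signs of the terms at
    \<open>h + 1\<close> and \<open>h - 1\<close>, which are the two negative ones in
    \<open>top_perm_sum_recurrence\<close>.\<close>
  also have "\<dots> = transfer q x k h + qnum q (Suc h) * transfer q x k (Suc h) +
    (if k = 0 then 0 else qnum q h * transfer q x (k - 1) h +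
      (if h = 0 then 0 else transfer q x (k - 1) (h - 1)))"
    unfolding x(1) transfer_minus_of_nat
    by (subst top_perm_sum_recurrence) (cases h; simp add: algebra_simps)
  finally show ?thesis .
qed

lemma transfer_eq_0:
  assumes "h > k"
  shows "transfer q x k h = 0"
  using assms by (simp add: transfer_def path_weight_eq_0 top_perm_sum_eq_0)

text \<open>An integer polynomial is determined by its values, which allows the indeterminate to be
  specialised to integers.\<close>

lemma int_poly_eqI:
  fixes p r :: "int poly"
  assumes "\<And>q. real_of_int (poly p q) = real_of_int (poly r q)"
  shows "p = r"
proof -
  have "poly p = poly r" using assms by (intro ext) (simp only: of_int_eq_iff)
  thus ?thesis by (simp only: poly_eq_poly_eq_iff)
qed

theorem theorem7p1:
  fixes n k :: nat
  assumes "k \<le> n"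
  shows "S2 n k =
    (-1) ^ (n - k) *
    (\<Sum>j = 0..n - k.
       (-1) ^ j * of_nat ((n + j - 1) choose (n - k + j)) *
       of_nat ((2 * n - k) choose (n - k - j)) * S1 (n - k + j) j)"
proof (rule int_poly_eqI)
  fix q :: int
  define m where "m = n - k"
  have m: "m \<le> n" "k = n - m" "2 * n - k = n + m" using assms by (simp_all add: m_def)
  let ?f = "\<lambda>x. transfer (of_int q) x m 0"
  \<comment> \<open>At \<open>h = 0\<close> the degree bound \<open>2 * m - h\<close> is one less
    than the number of nodes.\<close>
  have span: "binom_span (2 * m) ?f"
    using binom_span_transfer[of "transfer (of_int q)" "of_int q" m 0, OF transfer_eq_0 transfer_recurrence]
    by simp
  have zero: "?f (int i) = 0" if "1 \<le> i" "i \<le> m" for i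
    using that by (simp only: transfer_of_nat path_weight_full_eq_0)
  have "real_of_int (poly (S2 n k) q) = ?f (int n)"
    unfolding m(2) by (simp only: S2_eq_path_weight[OF m(1)] transfer_of_nat)
  also have "\<dots> = (\<Sum>j = 0..m. (-1) ^ (m + j) * real ((n + j - 1) choose (m + j)) *
      real ((n + m) choose (m - j)) * ?f (- int j))"
    by (rule binom_span_reflection[OF span zero m(1)])
  \<comment> \<open>For \<open>h = 0\<close> the sign in \<open>transfer\<close> is 1, and the words
    with nothing missing are the full permutations.\<close>
  also have "\<dots> = (\<Sum>j = 0..m. (-1) ^ (m + j) * real ((n + j - 1) choose (m + j)) *
      real ((n + m) choose (m - j)) * real_of_int (poly (S1 (m + j) j) q))"
    by (simp add: transfer_minus_of_nat S1_eq_top_perm_sum add.commute)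
  also have "\<dots> = real_of_int (poly ((-1) ^ m * (\<Sum>j = 0..m.
       (-1) ^ j * of_nat ((n + j - 1) choose (m + j)) *
       of_nat ((n + m) choose (m - j)) * S1 (m + j) j)) q)"
    by (simp add: poly_sum sum_distrib_left power_add mult_ac)
  finally show "real_of_int (poly (S2 n k) q) = real_of_int (poly ((-1) ^ (n - k) *
    (\<Sum>j = 0..n - k. (-1) ^ j * of_nat ((n + j - 1) choose (n - k + j)) *
       of_nat ((2 * n - k) choose (n - k - j)) * S1 (n - k + j) j)) q)"
    unfolding m(3) m_def[symmetric] .
qed

end
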